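(* Let $\mathcal{B}$ be a connected building set on $[n]$ which is invariant under the involution $\omega:[n]\to[n]$, $\omega(i)=n-i+1$ (i.e. $\omega(I)\in\mathcal{B}$ for all $I\in\mathcal{B}$). Then \[ h_{\mathcal{B}}(t,q,u)=t^{n-1}h_{\mathcal{B}}(t^{-1},q^{-1},qu). \]
   Context: A building set on $[n]$ is a collection $\mathcal{B}$ of nonempty subsets of $[n]$ closed under unions of intersecting members and containing all singletons; it is connected if $[n]\in\mathcal{B}$. For a rooted tree $T$ on $[n]$ and a vertex $i$, $T_{\le i}$ is the set of $i$ and its descendants. A $\mathcal{B}$-tree is a rooted tree $T$ on $[n]$ with $T_{\le i}\in\mathcal{B}$ for all $i$, and $\bigcup_{j=1}^k T_{\le i_j}\notin\mathcal{B}$ for any $k\ge2$ pairwise incomparable nodes $i_1,\ldots,i_k$. Write $x\lessdot_T y$ if $\{x,y\}$ is an edge of $T$ with $y$ closer to the root. $\mathrm{Des}(T)=\{(i,j): i\lessdot_T j,\ i>j\}$, $\mathrm{des}(T)=|\mathrm{Des}(T)|$; $\mathrm{dp}(x)$ is the length of the path from $x$ to the root, $\mathrm{depth}(T)=\max_x\mathrm{dp}(x)$, $\mathrm{maj}(T)=\sum_{(i,j)\in\mathrm{Des}(T)}(\mathrm{depth}(T)-\mathrm{dp}(j))$, and $\mu(T)=\sum_{i\lessdot_T j}(\mathrm{depth}(T)-\mathrm{dp}(j))$ (sum over all edges). Define $h_{\mathcal{B}}(t,q,u)=\sum_T t^{\mathrm{des}(T)}q^{\mathrm{maj}(T)}u^{\mu(T)}$,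 the sum over all $\mathcal{B}$-trees $T$. *)

theory Defs
  imports Main
begin

section \<open>Building sets\<close>

definition building_set :: "nat \<Rightarrow> nat set set \<Rightarrow> bool" where
  "building_set n B \<longleftrightarrow>
     (\<forall>I\<in>B. I \<noteq> {} \<and> I \<subseteq> {1..n}) \<and>
     (\<forall>I\<in>B. \<forall>J\<in>B. I \<inter> J \<noteq> {} \<longrightarrow> I \<union> J \<in> B) \<and>
     (\<forall>i\<in>{1..n}. {i} \<in> B)"

definition connected_building_set :: "nat \<Rightarrow> nat set set \<Rightarrow> bool" where
  "connected_building_set n B \<longleftrightarrow> building_set n B \<and> {1..n} \<in> B"

section \<open>Rooted trees\<close>

text \<open>A rooted tree is an undirected simple graph, whose edges are two-element sets of vertices,
  together with a distinguished vertex. Graph-theoretic paths are repetition-free vertex lists.\<close>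

record rtree =
  verts :: "nat set"
  edges :: "nat set set"
  root  :: nat

definition is_path :: "nat set set \<Rightarrow> nat \<Rightarrow> nat list \<Rightarrow> nat \<Rightarrow> bool" where
  "is_path E x p y \<longleftrightarrow>
     p \<noteq> [] \<and> hd p = x \<and> last p = y \<and> distinct p \<and>
     (\<forall>k. Suc k < length p \<longrightarrow> {p ! k, p ! Suc k} \<in> E)"

definition rooted_tree :: "rtree \<Rightarrow> bool" where
  "rooted_tree T \<longleftrightarrow>
     finite (verts T) \<and>
     edges T \<subseteq> {e. e \<subseteq> verts T \<and> card e = 2} \<and>
     (\<forall>x\<in>verts T. \<forall>y\<in>verts T. \<exists>!p. is_path (edges T) x p y) \<and>
     root T \<in> verts T"

definition root_path :: "rtree \<Rightarrow> nat \<Rightarrow> nat list" where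
  "root_path T x = (THE p. is_path (edges T) x p (root T))"

definition dp :: "rtree \<Rightarrow> nat \<Rightarrow> nat" where
  "dp T x = length (root_path T x) - 1"

definition depth :: "rtree \<Rightarrow> nat" where
  "depth T = Max (dp T ` verts T)"

text \<open>The set \<open>T\<^sub>\<le>\<^sub>i\<close>: a vertex is a descendant of \<open>i\<close> (or \<open>i\<close> itself) iff its path to the root
  passes through \<open>i\<close>.\<close>

definition subtree :: "rtree \<Rightarrow> nat \<Rightarrow> nat set" where
  "subtree T i = {x \<in> verts T. i \<in> set (root_path T x)}"

definition incomparable :: "rtree \<Rightarrow> nat \<Rightarrow> nat \<Rightarrow> bool" where
  "incomparable T i j \<longleftrightarrow> i \<notin> subtree T j \<and> j \<notin> subtree T i"

text \<open>The relation \<open>x \<lessdot>\<^sub>T y\<close>.\<close>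

definition covered :: "rtree \<Rightarrow> nat \<Rightarrow> nat \<Rightarrow> bool" where
  "covered T x y \<longleftrightarrow> {x, y} \<in> edges T \<and> dp T y < dp T x"

section \<open>Trees of a building set\<close>

definition B_trees :: "nat \<Rightarrow> nat set set \<Rightarrow> rtree set" where
  "B_trees n B = {T. rooted_tree T \<and> verts T = {1..n} \<and>
     (\<forall>i\<in>{1..n}. subtree T i \<in> B) \<and>
     (\<forall>S \<subseteq> {1..n}. card S \<ge> 2 \<and> (\<forall>i\<in>S. \<forall>j\<in>S. i \<noteq> j \<longrightarrow> incomparable T i j)
        \<longrightarrow> (\<Union>i\<in>S. subtree T i) \<notin> B)}"

text \<open>The sum defining \<open>h_poly\<close> below is over a finite set.\<close>

lemma finite_B_trees: "finite (B_trees n B)"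
proof (rule finite_subset)
  show "B_trees n B \<subseteq>
    (\<lambda>(E, r). \<lparr>verts = {1..n}, edges = E, root = r\<rparr>) ` (Pow (Pow {1..n}) \<times> {1..n})"
  proof
    fix T assume T: "T \<in> B_trees n B"
    obtain V E r where "T = \<lparr>verts = V, edges = E, root = r\<rparr>" by (cases T) auto
    moreover from this T have "V = {1..n}" "E \<in> Pow (Pow {1..n})" "r \<in> {1..n}"
      by (auto simp: B_trees_def rooted_tree_def)
    ultimately show "T \<in> (\<lambda>(E, r). \<lparr>verts = {1..n}, edges = E, root = r\<rparr>)
        ` (Pow (Pow {1..n}) \<times> {1..n})"
      by (intro image_eqI[of _ _ "(E, r)"]) auto
  qed
qed simp

definition Des :: "rtree \<Rightarrow> (nat \<times> nat) set" where
  "Des T = {(i, j). covered T i j \<and> i > j}"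

definition des :: "rtree \<Rightarrow> nat" where
  "des T = card (Des T)"

text \<open>Subtraction on \<^typ>\<open>nat\<close> never truncates here, since \<open>dp T j \<le> depth T\<close>.\<close>

definition maj :: "rtree \<Rightarrow> nat" where
  "maj T = (\<Sum>(i, j)\<in>Des T. depth T - dp T j)"

definition mu :: "rtree \<Rightarrow> nat" where
  "mu T = (\<Sum>(i, j)\<in>{(i, j). covered T i j}. depth T - dp T j)"

text \<open>The polynomial \<open>h\<^sub>B\<close>, given by its values in an arbitrary field. An identity
  that holds at all field elements, for all fields, is an identity of formal (Laurent) polynomials:
  take the field of fractions of the polynomial ring over the integers, and the indeterminates
  as arguments.\<close>

definition h_poly :: "nat \<Rightarrow> nat set set \<Rightarrow> 'a::field \<Rightarrow> 'a \<Rightarrow> 'a \<Rightarrow> 'a" where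
  "h_poly n B t q u = (\<Sum>T\<in>B_trees n B. t ^ des T * q ^ maj T * u ^ mu T)"

definition \<omega> :: "nat \<Rightarrow> nat \<Rightarrow> nat" where
  "\<omega> n i = n - i + 1"

end

theory Submission
  imports Defs
begin

text \<open>Relabelling the vertices by \<open>\<omega>\<close> is an involution on the \<open>B\<close>-trees. It preserves the depth
  of every vertex, hence \<open>\<mu>\<close>, and turns each descent edge into an ascent edge and vice versa. As a
  tree has \<open>n - 1\<close> edges, it sends \<open>des\<close> to \<open>n - 1 - des\<close> and \<open>maj\<close> to \<open>\<mu> - maj\<close>.\<close>

section \<open>Relabelling trees\<close>

text \<open>The map \<open>f\<close> acts on all natural numbers, not only on the vertices; taking
  it to be a bijection of the whole type frees the lemmas below from side conditions on where it is
  injective.\<close>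

definition relabel :: "(nat \<Rightarrow> nat) \<Rightarrow> rtree \<Rightarrow> rtree" where
  "relabel f T = \<lparr>verts = f ` verts T, edges = (`) f ` edges T, root = f (root T)\<rparr>"

lemma relabel_simps [simp]:
  "verts (relabel f T) = f ` verts T"
  "edges (relabel f T) = (`) f ` edges T"
  "root (relabel f T) = f (root T)"
  by (simp_all add: relabel_def)

lemma relabel_relabel: "relabel f (relabel g T) = relabel (f \<circ> g) T"
  by (simp add: relabel_def image_comp image_comp[symmetric] fun_eq_iff image_image)

lemma relabel_id [simp]: "relabel id T = T"
  by (simp add: relabel_def)

lemma doubleton_image_mem_iff:
  assumes "inj f"
  shows "{f a, f b} \<in> (`) f ` E \<longleftrightarrow> {a, b} \<in> E"
proof -
  have "{f a, f b} = f ` {a, b}" by simp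
  then show ?thesis
    using assms by (metis inj_image_mem_iff inj_on_image injI inj_image_eq_iff)
qed

text \<open>Injectivity keeps the list free of repetitions and ensures that no new edge appears
  between images of vertices, so paths correspond in both directions.\<close>

lemma is_path_map_iff:
  assumes "inj f"
  shows "is_path ((`) f ` E) (f x) (map f p) (f y) \<longleftrightarrow> is_path E x p y"
proof (cases "p = []")
  case False
  have "inj_on f (set p)" using assms by (rule inj_on_subset) simp
  then show ?thesis
    using False assms
    by (auto simp: is_path_def hd_map last_map distinct_map doubleton_image_mem_iff inj_eq)
qed (simp add: is_path_def)

lemma ex1_is_path_map:
  assumes "bij f" and "\<exists>!p. is_path E x p y"
  shows "\<exists>!p. is_path ((`) f ` E) (f x) p (f y)"
proof -
  have "inj f" using assms(1) by (rule bij_is_inj)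
  \<comment> \<open>Surjectivity lifts from \<open>f\<close> to lists, so any competing path in the
    relabelled graph has the form \<open>map f r\<close> and uniqueness can be pulled back to
    \<open>E\<close>.\<close>
  have "surj (map f)"
    using bij_is_surj[OF assms(1)] lists_image[of f UNIV] by simp
  obtain p where p: "is_path E x p y" "\<And>p'. is_path E x p' y \<Longrightarrow> p' = p"
    using assms(2) by blast
  show ?thesis
  proof (rule ex1I[of _ "map f p"])
    show "is_path ((`) f ` E) (f x) (map f p) (f y)"
      using p(1) is_path_map_iff[OF \<open>inj f\<close>] by simp
  next
    fix p' assume p': "is_path ((`) f ` E) (f x) p' (f y)"
    obtain r where r: "p' = map f r" using \<open>surj (map f)\<close> by (rule surjE)
    then have "is_path E x r y" using p' is_path_map_iff[OF \<open>inj f\<close>] by simp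
    then show "p' = map f p" using p(2) r by simp
  qed
qed

lemma rooted_tree_relabel:
  assumes "bij f" and "rooted_tree T"
  shows "rooted_tree (relabel f T)"
proof -
  have "inj f" using assms(1) by (simp add: bij_def)
  have "\<exists>!p. is_path ((`) f ` edges T) (f x) p (f y)" if "x \<in> verts T" "y \<in> verts T" for x y
    using assms that by (intro ex1_is_path_map) (auto simp: rooted_tree_def)
  moreover have "card (f ` e) = card e" for e
    using \<open>inj f\<close> by (meson card_image inj_on_subset subset_UNIV)
  ultimately show ?thesis
    using assms(2) by (fastforce simp: rooted_tree_def)
qed

section \<open>Paths to the root\<close>

lemma root_path_ex1:
  assumes "rooted_tree T" and "x \<in> verts T"
  shows "\<exists>!p. is_path (edges T) x p (root T)"
  using assms by (auto simp: rooted_tree_def)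

lemma is_path_root_path:
  assumes "rooted_tree T" and "x \<in> verts T"
  shows "is_path (edges T) x (root_path T x) (root T)"
  unfolding root_path_def using root_path_ex1[OF assms] by (rule theI')

lemma root_path_eqI:
  assumes "rooted_tree T" and "x \<in> verts T" and "is_path (edges T) x p (root T)"
  shows "root_path T x = p"
  unfolding root_path_def using root_path_ex1[OF assms(1,2)] assms(3) by (rule the1_equality)

lemma covered_verts:
  assumes "rooted_tree T" and "covered T x y"
  shows "x \<in> verts T" "y \<in> verts T"
  using assms by (auto simp: rooted_tree_def covered_def)

lemma finite_covered:
  assumes "rooted_tree T"
  shows "finite {(x, y). covered T x y}"
proof (rule finite_subset)
  show "{(x, y). covered T x y} \<subseteq> verts T \<times> verts T"
    using covered_verts[OF assms] by auto
qed (use assms in \<open>simp add: rooted_tree_def\<close>)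

lemma is_path_drop:
  assumes "is_path E x p y" and "k < length p"
  shows "is_path E (p ! k) (drop k p) y"
  using assms by (auto simp: is_path_def hd_drop_conv_nth less_diff_conv add.commute)

text \<open>This turns the depth comparison in \<open>covered\<close> into parenthood. If
  \<open>x\<close> lay on the root path of \<open>y\<close>, the suffix starting at \<open>x\<close>
  would be the root path of \<open>x\<close>, which contradicts \<open>dp T y < dp T x\<close>.
  Hence prepending \<open>x\<close> gives a repetition-free path, and root paths are unique.\<close>

lemma root_path_Cons:
  assumes "rooted_tree T" and "covered T x y"
  shows "root_path T x = x # root_path T y"
proof (rule root_path_eqI)
  have edge: "{x, y} \<in> edges T" and less: "dp T y < dp T x"
    using assms(2) by (auto simp: covered_def)
  have py: "is_path (edges T) y (root_path T y) (root T)"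
    using covered_verts(2)[OF assms] by (rule is_path_root_path[OF assms(1)])
  have "x \<notin> set (root_path T y)"
  proof
    assume "x \<in> set (root_path T y)"
    then obtain k where k: "k < length (root_path T y)" "root_path T y ! k = x"
      by (auto simp: in_set_conv_nth)
    then have "root_path T x = drop k (root_path T y)"
      using is_path_drop[OF py k(1)] covered_verts(1)[OF assms]
      by (intro root_path_eqI[OF assms(1)]) simp_all
    then show False using less by (simp add: dp_def)
  qed
  then show "is_path (edges T) x (x # root_path T y) (root T)"
    using py edge by (auto simp: is_path_def nth_Cons hd_conv_nth split: nat.split)
qed (use covered_verts[OF assms] assms in auto)

lemma covered_root_path_nth:
  assumes "rooted_tree T" and "x \<in> verts T" and "x \<noteq> root T"
  shows "covered T x (root_path T x ! 1)"
proof -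
  let ?p = "root_path T x"
  have p: "is_path (edges T) x ?p (root T)"
    by (rule is_path_root_path[OF assms(1,2)])
  \<comment> \<open>The case rule splits lists into empty, singleton and longer ones; a singleton
    path would force \<open>x = root T\<close>.\<close>
  then obtain y r where yr: "?p = x # y # r"
    using assms(3) by (cases ?p rule: remdups_adj.cases) (auto simp: is_path_def)
  have "{?p ! 0, ?p ! Suc 0} \<in> edges T"
    using p yr by (auto simp: is_path_def)
  then have edge: "{x, y} \<in> edges T" using yr by simp
  then have "y \<in> verts T" using assms(1) by (auto simp: rooted_tree_def)
  moreover have "is_path (edges T) y (y # r) (root T)"
    using is_path_drop[OF p, of 1] yr by simp
  ultimately have "root_path T y = y # r" by (rule root_path_eqI[OF assms(1)])
  then show ?thesis using yr edge by (simp add: covered_def dp_def)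
qed

lemma not_covered_root:
  assumes "rooted_tree T"
  shows "\<not> covered T (root T) y"
proof -
  have "root_path T (root T) = [root T]"
    using assms by (intro root_path_eqI) (auto simp: is_path_def rooted_tree_def)
  then show ?thesis by (simp add: covered_def dp_def)
qed

text \<open>Every vertex except the root has exactly one parent, the second entry of its root path.
  The covering pairs thus form the graph of a function on the non-root vertices.\<close>

lemma card_covered:
  assumes "rooted_tree T"
  shows "card {(x, y). covered T x y} = card (verts T) - 1"
proof -
  have "root_path T y ! 0 = y" if "y \<in> verts T" for y
    using is_path_root_path[OF assms that] by (auto simp: is_path_def hd_conv_nth)
  then have "root_path T x ! 1 = y" if "covered T x y" for x y
    using root_path_Cons[OF assms that] covered_verts[OF assms that] by simp
  then have "{(x, y). covered T x y} = (\<lambda>x. (x, root_path T x ! 1)) ` (verts T - {root T})"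
    using covered_verts[OF assms] not_covered_root[OF assms] covered_root_path_nth[OF assms]
    by (auto simp: image_iff)
  moreover have "inj_on (\<lambda>x. (x, root_path T x ! 1)) (verts T - {root T})"
    by (auto intro: inj_onI)
  ultimately show ?thesis
    using assms by (simp add: card_image rooted_tree_def)
qed

section \<open>Invariance of root paths, depths, subtrees and B-trees under relabelling\<close>

lemma root_path_relabel:
  assumes "bij f" and "rooted_tree T" and "x \<in> verts T"
  shows "root_path (relabel f T) (f x) = map f (root_path T x)"
proof (rule root_path_eqI)
  show "rooted_tree (relabel f T)" using assms(1,2) by (rule rooted_tree_relabel)
  show "f x \<in> verts (relabel f T)" using assms(3) by simp
  show "is_path (edges (relabel f T)) (f x) (map f (root_path T x)) (root (relabel f T))"
    using is_path_root_path[OF assms(2,3)] is_path_map_iff[OF bij_is_inj[OF assms(1)]] by simp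
qed

lemma dp_relabel:
  assumes "bij f" and "rooted_tree T" and "x \<in> verts T"
  shows "dp (relabel f T) (f x) = dp T x"
  by (simp add: dp_def root_path_relabel[OF assms])

lemma depth_relabel:
  assumes "bij f" and "rooted_tree T"
  shows "depth (relabel f T) = depth T"
proof -
  have "dp (relabel f T) ` f ` verts T = dp T ` verts T"
    unfolding image_image by (rule image_cong[OF refl]) (rule dp_relabel[OF assms])
  then show ?thesis by (simp add: depth_def)
qed

lemma subtree_relabel:
  assumes "bij f" and "rooted_tree T"
  shows "subtree (relabel f T) (f i) = f ` subtree T i"
proof -
  have "f i \<in> set (root_path (relabel f T) (f x)) \<longleftrightarrow> i \<in> set (root_path T x)"
    if "x \<in> verts T" for x
    by (simp add: root_path_relabel[OF assms that] inj_image_mem_iff[OF bij_is_inj[OF assms(1)]])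
  then show ?thesis unfolding subtree_def relabel_simps by blast
qed

lemma incomparable_relabel:
  assumes "bij f" and "rooted_tree T"
  shows "incomparable (relabel f T) (f i) (f j) \<longleftrightarrow> incomparable T i j"
  unfolding incomparable_def subtree_relabel[OF assms]
  by (simp add: inj_image_mem_iff[OF bij_is_inj[OF assms(1)]])

lemma covered_relabel:
  assumes "bij f" and "rooted_tree T"
  shows "covered (relabel f T) (f x) (f y) \<longleftrightarrow> covered T x y"
proof -
  have "{x, y} \<in> edges T \<Longrightarrow> x \<in> verts T \<and> y \<in> verts T"
    using assms(2) by (auto simp: rooted_tree_def)
  then show ?thesis
    using assms dp_relabel[OF assms]
    by (auto simp: covered_def doubleton_image_mem_iff bij_def)
qed

text \<open>Both conditions on a B-tree involve only subtrees and incomparability, which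
  \<open>f\<close> transports. Membership of subtrees uses that \<open>f\<close> maps
  \<open>B\<close> into itself; non-membership of unions uses the converse direction of the
  equivalence.\<close>

lemma relabel_B_trees:
  assumes f: "bij f" "f ` {1..n} = {1..n}"
    and B: "\<And>I. I \<subseteq> {1..n} \<Longrightarrow> f ` I \<in> B \<longleftrightarrow> I \<in> B"
    and T: "T \<in> B_trees n B"
  shows "relabel f T \<in> B_trees n B"
proof -
  have tree: "rooted_tree T" and verts: "verts T = {1..n}"
    and sub: "\<And>i. i \<in> {1..n} \<Longrightarrow> subtree T i \<in> B"
    and incomp: "\<And>S. \<lbrakk>S \<subseteq> {1..n}; card S \<ge> 2; \<forall>i\<in>S. \<forall>j\<in>S. i \<noteq> j \<longrightarrow> incomparable T i j\<rbrakk>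
      \<Longrightarrow> (\<Union>i\<in>S. subtree T i) \<notin> B"
    using T by (auto simp: B_trees_def)
  have sub_verts: "subtree T i \<subseteq> {1..n}" for i
    by (auto simp: subtree_def verts)
  note subtree' = subtree_relabel[OF f(1) tree]
  have "subtree (relabel f T) i \<in> B" if "i \<in> {1..n}" for i
  proof -
    have "i \<in> f ` {1..n}" using that by (simp only: f(2))
    then obtain k where k: "i = f k" "k \<in> {1..n}" by (rule imageE)
    have "f ` subtree T k \<in> B" using B[OF sub_verts] sub[OF k(2)] by (rule iffD2)
    then show ?thesis by (simp only: k(1) subtree')
  qed
  moreover have "(\<Union>i\<in>S. subtree (relabel f T) i) \<notin> B"
    if S: "S \<subseteq> {1..n}" "card S \<ge> 2"
      "\<forall>i\<in>S. \<forall>j\<in>S. i \<noteq> j \<longrightarrow> incomparable (relabel f T) i j" for S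
  proof -
    \<comment> \<open>An incomparable family in the relabelled tree is pulled back to a family
      \<open>R\<close> of the same size in \<open>T\<close>.\<close>
    have "S \<subseteq> f ` {1..n}" using S(1) by (simp only: f(2))
    then obtain R where R: "R \<subseteq> {1..n}" "S = f ` R" by (rule subset_imageE)
    have "inj f" using f(1) by (simp add: bij_def)
    then have "card S = card R"
      unfolding R(2) by (intro card_image) (rule inj_on_subset, auto)
    moreover have "\<forall>i\<in>R. \<forall>j\<in>R. i \<noteq> j \<longrightarrow> incomparable T i j"
      using S(3) \<open>inj f\<close> by (auto simp: R(2) incomparable_relabel[OF f(1) tree] inj_eq)
    ultimately have "(\<Union>i\<in>R. subtree T i) \<notin> B" using R(1) S(2) by (intro incomp) simp_all
    moreover have "(\<Union>i\<in>S. subtree (relabel f T) i) = f ` (\<Union>i\<in>R. subtree T i)"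
      by (simp add: R(2) subtree' image_UN)
    moreover have "(\<Union>i\<in>R. subtree T i) \<subseteq> {1..n}" using sub_verts by blast
    ultimately show ?thesis by (simp only: B not_False_eq_True)
  qed
  ultimately show ?thesis
    using rooted_tree_relabel[OF f(1) tree] f(2) verts
    unfolding B_trees_def mem_Collect_eq relabel_simps by metis
qed

section \<open>Descents of the relabelled tree\<close>

lemma covered_neq: "covered T x y \<Longrightarrow> x \<noteq> y"
  by (auto simp: covered_def)

lemma covered_relabel_eq_image:
  assumes "bij f" and "rooted_tree T"
  shows "{(x, y). covered (relabel f T) x y} = map_prod f f ` {(x, y). covered T x y}"
proof -
  have "surj f" using assms(1) by (simp add: bij_def)
  have "(x, y) \<in> map_prod f f ` {(x, y). covered T x y}" if "covered (relabel f T) x y" for x y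
  proof -
    obtain a b where "x = f a" "y = f b" using \<open>surj f\<close> by (metis surjD)
    then show ?thesis using that covered_relabel[OF assms] by auto
  qed
  then show ?thesis using covered_relabel[OF assms] by auto
qed

text \<open>The weight of a covering pair depends only on depths, which relabelling
  preserves.\<close>

lemma mu_relabel:
  assumes "bij f" and "rooted_tree T"
  shows "mu (relabel f T) = mu T"
proof -
  have "inj_on (map_prod f f) {(x, y). covered T x y}"
    using assms(1) by (auto intro!: inj_onI simp: bij_def inj_eq)
  then show ?thesis
    unfolding mu_def covered_relabel_eq_image[OF assms]
    by (subst sum.reindex)
      (auto intro!: sum.cong simp: depth_relabel[OF assms] dp_relabel[OF assms]
        dest: covered_verts[OF assms(2)])
qed

lemma Des_relabel:
  assumes "bij f" and "rooted_tree T"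
    and anti: "\<And>x y. \<lbrakk>x \<in> verts T; y \<in> verts T; x < y\<rbrakk> \<Longrightarrow> f y < f x"
  shows "Des (relabel f T) = map_prod f f ` ({(x, y). covered T x y} - Des T)"
proof -
  \<comment> \<open>The two ends of a covering pair differ, so failing to be a descent means being
    an ascent, which an order-reversing \<open>f\<close> turns into a descent.\<close>
  have *: "f y < f x \<longleftrightarrow> \<not> y < x" if "covered T x y" for x y
    using anti[of x y] anti[of y x] covered_verts[OF assms(2) that] covered_neq[OF that]
    by (metis not_less_iff_gr_or_eq)
  have "Des (relabel f T) = {(x, y). covered (relabel f T) x y} \<inter> {(x, y). y < x}"
    by (auto simp: Des_def)
  then show ?thesis
    unfolding covered_relabel_eq_image[OF assms(1,2)] using * by (auto simp: Des_def)
qed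

text \<open>The descents of the relabelled tree are the images of the covering pairs of
  \<open>T\<close> that are not descents. Counting this complement gives the first identity, summing
  its unchanged weights gives the second.\<close>

lemma
  assumes f: "bij f" and tree: "rooted_tree T"
    and anti: "\<And>x y. \<lbrakk>x \<in> verts T; y \<in> verts T; x < y\<rbrakk> \<Longrightarrow> f y < f x"
  shows des_relabel: "des (relabel f T) + des T = card (verts T) - 1"
    and maj_relabel: "maj (relabel f T) + maj T = mu T"
proof -
  let ?C = "{(x, y). covered T x y}"
  have sub: "Des T \<subseteq> ?C" by (auto simp: Des_def)
  have fin: "finite ?C" by (rule finite_covered[OF tree])
  have inj: "inj_on (map_prod f f) (?C - Des T)"
    using f by (auto intro!: inj_onI simp: bij_def inj_eq)
  have Des: "Des (relabel f T) = map_prod f f ` (?C - Des T)"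
    using f tree anti by (rule Des_relabel)
  have "des (relabel f T) = card (?C - Des T)"
    using inj by (simp add: des_def Des card_image)
  also have "\<dots> + des T = card ?C"
    unfolding des_def using sub fin
    by (simp add: card_Diff_subset card_mono finite_subset)
  finally show "des (relabel f T) + des T = card (verts T) - 1"
    by (simp add: card_covered[OF tree])
  have "maj (relabel f T) = (\<Sum>(i, j)\<in>?C - Des T. depth T - dp T j)"
    unfolding maj_def Des using inj
    by (subst sum.reindex)
      (auto intro!: sum.cong simp: depth_relabel[OF f tree] dp_relabel[OF f tree]
        dest: covered_verts[OF tree])
  also have "\<dots> + maj T = mu T"
    unfolding maj_def mu_def using sum.subset_diff[OF sub fin] by metis
  finally show "maj (relabel f T) + maj T = mu T" .
qed

text \<open>\<open>\<omega> n\<close> is not injective on all of \<^typ>\<open>nat\<close>, because subtraction truncates.\<close>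

definition reflection :: "nat \<Rightarrow> nat \<Rightarrow> nat" where
  "reflection n i = (if i \<in> {1..n} then \<omega> n i else i)"

lemma reflection_reflection [simp]: "reflection n (reflection n i) = i"
  by (auto simp: reflection_def \<omega>_def)

lemma bij_reflection: "bij (reflection n)"
  by (rule o_bij[of "reflection n"]) auto

lemma reflection_image_interval: "reflection n ` {1..n} = {1..n}"
proof -
  have sub: "reflection n ` {1..n} \<subseteq> {1..n}" by (auto simp: reflection_def \<omega>_def)
  \<comment> \<open>Applying the involution to the inclusion just shown yields the reverse
    inclusion.\<close>
  then have "reflection n ` reflection n ` {1..n} \<subseteq> reflection n ` {1..n}" by (rule image_mono)
  with sub show ?thesis by (auto simp: image_image)
qed

lemma reflection_antimono:
  "\<lbrakk>x \<in> {1..n}; y \<in> {1..n}; x < y\<rbrakk> \<Longrightarrow> reflection n y < reflection n x"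
  by (auto simp: reflection_def \<omega>_def)

theorem theorem4p9:
  fixes n :: nat and B :: "nat set set" and t q u :: "'a::field"
  assumes "connected_building_set n B"
    and "\<forall>I\<in>B. \<omega> n ` I \<in> B"
    and "t \<noteq> 0" and "q \<noteq> 0"
  shows "h_poly n B t q u = t ^ (n - 1) * h_poly n B (inverse t) (inverse q) (q * u)"
proof -
  let ?r = "reflection n"
  let ?R = "relabel ?r"
  have image: "?r ` I = \<omega> n ` I" if "I \<subseteq> {1..n}" for I
    using that by (intro image_cong) (auto simp: reflection_def)
  have B: "?r ` I \<in> B \<longleftrightarrow> I \<in> B" if I: "I \<subseteq> {1..n}" for I
  proof
    show "I \<in> B \<Longrightarrow> ?r ` I \<in> B" using assms(2) image[OF I] by simp
    assume "?r ` I \<in> B"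
    moreover have "?r ` I \<subseteq> {1..n}" using image_mono[OF I] reflection_image_interval by metis
    \<comment> \<open>Invariance of \<open>B\<close> is assumed in one direction only; reflecting a
      second time supplies the other.\<close>
    ultimately have "?r ` ?r ` I \<in> B" using assms(2) image by metis
    then show "I \<in> B" by (simp add: image_image)
  qed
  have closed: "?R T \<in> B_trees n B" if "T \<in> B_trees n B" for T
    using relabel_B_trees[OF bij_reflection reflection_image_interval B that] by simp
  have "?r \<circ> ?r = id" by (simp add: fun_eq_iff)
  then have invol: "?R (?R T) = T" for T by (simp add: relabel_relabel)
  \<comment> \<open>The identity holds term by term once \<open>T\<close> on one side is matched
    with its reflection on the other.\<close>
  have weight: "t ^ (n - 1) * (inverse t ^ des (?R T) * inverse q ^ maj (?R T) * (q * u) ^ mu (?R T))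
      = t ^ des T * q ^ maj T * u ^ mu T" if T: "T \<in> B_trees n B" for T
  proof -
    have tree: "rooted_tree T" and verts: "verts T = {1..n}" using T by (auto simp: B_trees_def)
    have anti: "?r y < ?r x" if "x \<in> verts T" "y \<in> verts T" "x < y" for x y
      using that verts reflection_antimono by simp
    have "des (?R T) + des T = n - 1"
      using des_relabel[OF bij_reflection tree anti] verts by simp
    then have "t ^ (n - 1) = t ^ des (?R T) * t ^ des T" by (metis power_add)
    then have t: "t ^ (n - 1) * inverse t ^ des (?R T) = t ^ des T"
      using assms(3) by (simp add: field_simps)
     have maj: "maj (?R T) + maj T = mu T"
      by (rule maj_relabel[OF bij_reflection tree anti])
    \<comment> \<open>The factor \<open>q ^ mu T\<close> comes from the third argument
      \<open>q * u\<close>, since \<open>mu\<close> is invariant. Writing \<open>mu T\<close> as the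
      sum of both \<open>maj\<close> values cancels the inverse powers.\<close>
    have q: "inverse q ^ maj (?R T) * q ^ mu T = q ^ maj T"
      using assms(4) by (simp add: power_add field_simps flip: maj)
    have "t ^ (n - 1) * (inverse t ^ des (?R T) * inverse q ^ maj (?R T) * (q * u) ^ mu (?R T))
        = (t ^ (n - 1) * inverse t ^ des (?R T)) * (inverse q ^ maj (?R T) * q ^ mu T) * u ^ mu T"
      by (simp add: mu_relabel[OF bij_reflection tree] power_mult_distrib mult_ac)
    then show ?thesis by (simp only: t q)
  qed
  have "h_poly n B t q u = (\<Sum>T\<in>B_trees n B.
      t ^ (n - 1) * (inverse t ^ des T * inverse q ^ maj T * (q * u) ^ mu T))"
    unfolding h_poly_def
    \<comment> \<open>Relabelling is its own inverse on the B-trees, so it serves as both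
      witnesses.\<close>
    by (rule sum.reindex_bij_witness[of _ ?R ?R]) (simp_all only: invol closed weight)
  then show ?thesis by (simp add: h_poly_def sum_distrib_left)
qed

end
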